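(* Let $\{G(k)\}_{k\ge0}$, $G(k)=([m],\mathcal{E}(k))$, be a deterministic sequence of simple undirected graphs, let $N_i(k)=\{j\in[m]\mid\{i,j\}\in\mathcal{E}(k)\}$, let $\gamma\in(0,1)$, and let $\gamma(k)\in(0,\gamma]$ for each $k\ge0$. Consider the time-varying broadcast gossip model: the random matrices $W(k)$, $k\ge0$, are independent and, for each $k$ and each $i\in[m]$, $$W(k)=I-\gamma(k)\sum_{j\in N_i(k)}e_j(e_j-e_i)^T\qquad\text{with probability }\tfrac1m$$ (the event that agent $i$ wakes up at time $k$ and broadcasts its value). Let $G_b^\infty$ be the infinite flow graph of this model. Then the model $\{W(k)\}$ is stable almost surely. Furthermore, any two agents $i,j\in[m]$ are in the same ergodicity class if and only if they belong to the same connected component of $G_b^\infty$. In particular, the model is ergodic if and only if $G_b^\infty$ is connected.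
   Context: $[m]=\{1,\dots,m\}$; $e_i\in\mathbb{R}^m$ is the $i$th standard basis column vector; $I$ is the $m\times m$ identity matrix. The dynamics associated with $\{W(k)\}$ is $x(k+1)=W(k)x(k)$ for $k\ge t_0$. Infinite flow graph of a random model $\{W(k)\}$: the simple undirected graph on vertex set $[m]$ in which $\{i,j\}$, $i\ne j$, is an edge if and only if $\sum_{k=0}^\infty(W_{ij}(k)+W_{ji}(k))=\infty$ almost surely. Connected components are maximal. For a deterministic chain: indices $i,j$ are mutually weakly ergodic ($i\leftrightarrow j$) if $\lim_{k\to\infty}(x_i(k)-x_j(k))=0$ for every $t_0\ge0$ and every $x(t_0)\in\mathbb{R}^m$; an index $i$ is ergodic if $\lim_{k\to\infty}x_i(k)$ exists for every $t_0\ge0$ and every $x(t_0)\in\mathbb{R}^m$; the chain is stable if every index is ergodic; the chain is ergodic if all pairs $i,j\in[m]$ are mutually weakly ergodic. A random model has one of these properties if it holds almost surely (for almost every realization of the chain). The ergodicity classes of the model are the equivalence classes of the relation $\leftrightarrow$ on $[m]$ (with $i\leftrightarrow j$ for an independent random model meaning that $i\leftrightarrow j$ holds almost surely). *)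

theory Defs
  imports "Graph_Theory.Digraph_Component" "HOL-Probability.Probability"
begin

text \<open>
  A chain is a sequence of square real matrices, with the finite index type in the role of
  \<open>[m]\<close>.  A random model is a sequence of matrix-valued functions \<open>W k\<close> on a probability
  space \<open>M\<close>; its realization at \<open>\<omega>\<close> is the chain \<open>\<lambda>k. W k \<omega>\<close>.
\<close>

subsection \<open>Dynamics and ergodicity\<close>

text \<open>The values of a trajectory before the starting time \<open>t0\<close> are irrelevant.\<close>

definition trajectory :: "(nat \<Rightarrow> real^'m^'m) \<Rightarrow> nat \<Rightarrow> (nat \<Rightarrow> real^'m) \<Rightarrow> bool" where
  "trajectory A t0 x \<longleftrightarrow> (\<forall>k\<ge>t0. x (Suc k) = A k *v x k)"

definition mutually_weakly_ergodic :: "(nat \<Rightarrow> real^'m^'m) \<Rightarrow> 'm \<Rightarrow> 'm \<Rightarrow> bool" where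
  "mutually_weakly_ergodic A i j \<longleftrightarrow>
     (\<forall>t0 x. trajectory A t0 x \<longrightarrow> (\<lambda>k. x k $ i - x k $ j) \<longlonglongrightarrow> 0)"

definition ergodic_index :: "(nat \<Rightarrow> real^'m^'m) \<Rightarrow> 'm \<Rightarrow> bool" where
  "ergodic_index A i \<longleftrightarrow> (\<forall>t0 x. trajectory A t0 x \<longrightarrow> convergent (\<lambda>k. x k $ i))"

definition stable_chain :: "(nat \<Rightarrow> real^'m^'m) \<Rightarrow> bool" where
  "stable_chain A \<longleftrightarrow> (\<forall>i. ergodic_index A i)"

definition ergodic_chain :: "(nat \<Rightarrow> real^'m^'m) \<Rightarrow> bool" where
  "ergodic_chain A \<longleftrightarrow> (\<forall>i j. mutually_weakly_ergodic A i j)"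

definition ergodicity_classes :: "'w measure \<Rightarrow> (nat \<Rightarrow> 'w \<Rightarrow> real^'m^'m) \<Rightarrow> 'm set set" where
  "ergodicity_classes M W =
     UNIV // {(i, j). AE \<omega> in M. mutually_weakly_ergodic (\<lambda>k. W k \<omega>) i j}"

subsection \<open>Infinite flow graph\<close>

text \<open>
  A simple undirected graph is represented as a symmetric loop-free digraph, an edge
  \<open>{i, j}\<close> being the pair of arcs \<open>(i, j)\<close> and \<open>(j, i)\<close>; see \<^locale>\<open>pair_graph\<close>.
  The sum being infinite means that its partial sums diverge to infinity.
\<close>

definition infinite_flow_graph ::
    "'w measure \<Rightarrow> (nat \<Rightarrow> 'w \<Rightarrow> real^'m^'m) \<Rightarrow> 'm pair_pre_digraph" where
  "infinite_flow_graph M W =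
     \<lparr> pverts = UNIV,
       parcs = {(i, j). i \<noteq> j \<and>
         (AE \<omega> in M. filterlim (\<lambda>n. \<Sum>k<n. W k \<omega> $ i $ j + W k \<omega> $ j $ i) at_top sequentially)} \<rparr>"

definition connected_components :: "'m pair_pre_digraph \<Rightarrow> ('m, 'm \<times> 'm) pre_digraph set" where
  "connected_components G =
     {C. pre_digraph.max_subgraph (with_proj G) Digraph_Component.connected C}"

subsection \<open>Time-varying broadcast gossip\<close>

definition neighbours :: "'m pair_pre_digraph \<Rightarrow> 'm \<Rightarrow> 'm set" where
  "neighbours G i = {j. (i, j) \<in> parcs G}"

definition basis_vec :: "'m \<Rightarrow> real^'m::finite" where
  "basis_vec i = axis i 1"

text \<open>In the product of a column and a row vector, the common index type of size one is \<open>1\<close>.\<close>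

definition broadcast_matrix :: "'m pair_pre_digraph \<Rightarrow> real \<Rightarrow> 'm \<Rightarrow> real^'m::finite^'m" where
  "broadcast_matrix G c i =
     mat 1 - c *\<^sub>R (\<Sum>j\<in>neighbours G i.
       (columnvector (basis_vec j) :: real^1^'m) **
       (rowvector (basis_vec j - basis_vec i) :: real^'m^1))"

text \<open>
  The agent waking up at time \<open>k\<close> is uniform on the index type, so the law of \<open>W k\<close> is the image
  of the uniform distribution under the broadcast matrix.  In particular, agents with the same
  matrix (e.g. agents without neighbours) contribute their probabilities cumulatively.
\<close>

definition broadcast_gossip_model ::
    "'w measure \<Rightarrow> (nat \<Rightarrow> 'm::finite pair_pre_digraph) \<Rightarrow> (nat \<Rightarrow> real) \<Rightarrow>
     (nat \<Rightarrow> 'w \<Rightarrow> real^'m^'m) \<Rightarrow> bool" where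
  "broadcast_gossip_model M G c W \<longleftrightarrow>
     prob_space M \<and>
     prob_space.indep_vars M (\<lambda>_. borel) W UNIV \<and>
     (\<forall>k. distr M borel (W k) =
          distr (measure_pmf (pmf_of_set UNIV)) borel (broadcast_matrix (G k) (c k)))"

end

theory Submission
  imports Defs
begin

text \<open>
  Since the graphs are undirected and the waking agent is uniform, the expected energy
  \<open>\<Sum>i. (x\<^sub>i)\<^sup>2\<close> decreases at each step by at least \<open>1 - \<gamma>\<close> times the expected disagreement
  \<open>\<Sum>i j. W\<^sub>i\<^sub>j (x\<^sub>i - x\<^sub>j)\<^sup>2\<close>.  Hence almost surely the disagreement along a trajectory is summable, and
  the rest of the argument for stability is deterministic: once the remaining disagreement is tiny
  compared with \<open>\<delta>\<^sup>2\<close>, no gap of width \<open>\<delta>\<close> in the set of values can be bridged any more, so every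
  agent stays within distance \<open>(m + 1) \<delta>\<close> of its present value.  The limits of two agents joined by an
  infinite flow agree, as otherwise the disagreement would not be summable.

  By independence (a second Borel-Cantelli argument), a pair that is not an edge of the infinite flow
  graph has deterministically summable weights \<open>\<gamma>(k)\<close>.  Thus the total flow out of a connected component
  after a late time is small, and a trajectory started from the indicator of the component keeps the
  component apart from its complement.
\<close>

subsection \<open>Summable disagreement\<close>

definition row_stochastic :: "real^'n^'n \<Rightarrow> bool" where
  "row_stochastic A \<longleftrightarrow> (\<forall>i j. 0 \<le> A $ i $ j) \<and> (\<forall>i. (\<Sum>j\<in>UNIV. A $ i $ j) = 1)"

definition disagreement :: "real^'n^'n \<Rightarrow> real^'n \<Rightarrow> real" where
  "disagreement A x = (\<Sum>i\<in>UNIV. \<Sum>j\<in>UNIV. A $ i $ j * (x $ i - x $ j)\<^sup>2)"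

lemma row_stochastic_nonneg: "row_stochastic A \<Longrightarrow> 0 \<le> A $ i $ j"
  by (simp add: row_stochastic_def)

lemma disagreement_nonneg: "row_stochastic A \<Longrightarrow> 0 \<le> disagreement A x"
  by (simp add: disagreement_def row_stochastic_nonneg sum_nonneg)

lemma disagreement_uminus: "disagreement A (- x) = disagreement A x"
  unfolding disagreement_def by (intro sum.cong refl) (simp add: power2_eq_square algebra_simps)

lemma disagreement_ge_partial_row:
  assumes "row_stochastic A"
  shows "(\<Sum>j\<in>T. A $ i $ j * (x $ i - x $ j)\<^sup>2) \<le> disagreement A x"
proof -
  have "(\<Sum>j\<in>T. A $ i $ j * (x $ i - x $ j)\<^sup>2) \<le> (\<Sum>j\<in>UNIV. A $ i $ j * (x $ i - x $ j)\<^sup>2)"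
    using assms by (intro sum_mono2) (auto simp: row_stochastic_nonneg)
  also have "\<dots> \<le> disagreement A x"
    unfolding disagreement_def
    using assms by (intro member_le_sum) (auto simp: row_stochastic_nonneg intro!: sum_nonneg)
  finally show ?thesis .
qed

section \<open>Averaging bounds, gaps between values and convergence\<close>

lemma row_stochastic_mult_nth:
  assumes "row_stochastic A"
  shows "(A *v x) $ i = x $ i + (\<Sum>j\<in>UNIV. A $ i $ j * (x $ j - x $ i))"
proof -
  have "(\<Sum>j\<in>UNIV. A $ i $ j * (x $ j - x $ i)) =
      (\<Sum>j\<in>UNIV. A $ i $ j * x $ j) - (\<Sum>j\<in>UNIV. A $ i $ j) * x $ i"
    by (simp add: sum_distrib_right sum_subtractf right_diff_distrib)
  then show ?thesis
    using assms by (simp add: row_stochastic_def matrix_vector_mult_def)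
qed

text \<open>Relative to \<open>x $ i\<close>, the terms inside \<open>S\<close> add at most
  \<open>u - x $ i\<close>: their weights are nonnegative with sum at most 1, and
  \<open>u - x $ i\<close> is nonnegative because \<open>i\<close> lies in \<open>S\<close>. Only
  agents outside \<open>S\<close> can push the new value above \<open>u\<close>. Both the gap
  argument and the cut argument iterate this bound.\<close>

lemma row_stochastic_upper_bound:
  assumes A: "row_stochastic A" and i: "i \<in> S" and u: "\<And>j. j \<in> S \<Longrightarrow> x $ j \<le> u"
  shows "(A *v x) $ i \<le> u + (\<Sum>j\<in>-S. A $ i $ j * (x $ j - x $ i))"
proof -
  have split: "(\<Sum>j\<in>UNIV. f j) = (\<Sum>j\<in>S. f j) + (\<Sum>j\<in>-S. f j)" for f :: "'a \<Rightarrow> real"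
    using sum.union_disjoint[of S "-S" f] by simp
  have "(\<Sum>j\<in>S. A $ i $ j * (x $ j - x $ i)) \<le> (\<Sum>j\<in>S. A $ i $ j * (u - x $ i))"
    using u A by (intro sum_mono mult_left_mono) (auto simp: row_stochastic_nonneg)
  also have "\<dots> = (\<Sum>j\<in>S. A $ i $ j) * (u - x $ i)"
    by (simp add: sum_distrib_right)
  also have "\<dots> \<le> 1 * (u - x $ i)"
  proof (intro mult_right_mono)
    have "(\<Sum>j\<in>S. A $ i $ j) \<le> (\<Sum>j\<in>UNIV. A $ i $ j)"
      using A by (intro sum_mono2) (auto simp: row_stochastic_nonneg)
    then show "(\<Sum>j\<in>S. A $ i $ j) \<le> 1"
      using A by (simp add: row_stochastic_def)
  qed (use u i in auto)
  finally show ?thesis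
    unfolding row_stochastic_mult_nth[OF A] split by simp
qed

lemma row_stochastic_lower_bound:
  assumes "row_stochastic A" and "i \<in> S" and "\<And>j. j \<in> S \<Longrightarrow> l \<le> x $ j"
  shows "l + (\<Sum>j\<in>-S. A $ i $ j * (x $ j - x $ i)) \<le> (A *v x) $ i"
proof -
  have "(A *v (- x)) $ i \<le> - l + (\<Sum>j\<in>-S. A $ i $ j * ((- x) $ j - (- x) $ i))"
    using assms by (intro row_stochastic_upper_bound) auto
  moreover have "(\<Sum>j\<in>-S. A $ i $ j * ((- x) $ j - (- x) $ i)) =
      - (\<Sum>j\<in>-S. A $ i $ j * (x $ j - x $ i))"
    by (simp add: sum_negf[symmetric] algebra_simps)
  moreover have "A *v (- x) = - (A *v x)"
    by (simp add: vec_eq_iff matrix_vector_mult_def sum_negf)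
  ultimately show ?thesis by simp
qed

text \<open>
  Crossing a gap of width at least \<open>\<delta> / 2\<close> with weight \<open>a\<close> moves an agent by at most
  \<open>2 / \<delta>\<close> times its share of the disagreement, so a small total disagreement cannot close the gap.
\<close>

lemma gap_persists:
  assumes A: "\<And>k. row_stochastic (A k)" and x: "\<And>k. x (Suc k) = A k *v x k"
    and \<delta>: "0 < \<delta>"
    and below: "\<And>i. i \<in> S \<Longrightarrow> x 0 $ i \<le> \<theta>" and above: "\<And>i. i \<notin> S \<Longrightarrow> \<theta> + \<delta> \<le> x 0 $ i"
    and small: "\<And>n. (\<Sum>k<n. disagreement (A k) (x k)) \<le> \<delta>\<^sup>2 / 16"
    and i: "i \<in> S"
  shows "x n $ i \<le> \<theta> + \<delta> / 8"
proof -
  \<comment> \<open>\<open>D n\<close> bounds how far either side has moved into the gap. The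
    hypothesis \<open>small\<close> keeps it at most \<open>\<delta> / 8\<close>, so the gap keeps
    at least 3/4 of its width, more than the \<open>\<delta> / 2\<close> that \<open>cross\<close>
    relies on.\<close>
  define D where "D n = (2 / \<delta>) * (\<Sum>k<n. disagreement (A k) (x k))" for n
  have D: "D n \<le> \<delta> / 8" for n
  proof -
    have "D n \<le> (2 / \<delta>) * (\<delta>\<^sup>2 / 16)"
      unfolding D_def using small \<delta> by (intro mult_left_mono) auto
    also have "\<dots> = \<delta> / 8" using \<delta> by (simp add: power2_eq_square)
    finally show ?thesis .
  qed
  have inv: "(\<forall>i\<in>S. x n $ i \<le> \<theta> + D n) \<and> (\<forall>i\<in>-S. \<theta> + \<delta> - D n \<le> x n $ i)" for n
  proof (induction n)
    case 0
    show ?case using below above by (auto simp: D_def)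
  next
    case (Suc n)
    have gap: "\<delta> / 2 \<le> x n $ j - x n $ i" if "i \<in> S" "j \<in> -S" for i j
    proof -
      have "x n $ i \<le> \<theta> + D n" "\<theta> + \<delta> - D n \<le> x n $ j" using Suc that by auto
      then show ?thesis using D[of n] \<delta> by linarith
    qed
    have cross: "A n $ i $ j * (x n $ j - x n $ i) \<le> 2 / \<delta> * (A n $ i $ j * (x n $ i - x n $ j)\<^sup>2) \<and>
        A n $ j $ i * (x n $ j - x n $ i) \<le> 2 / \<delta> * (A n $ j $ i * (x n $ j - x n $ i)\<^sup>2)"
      if "i \<in> S" "j \<in> -S" for i j
    proof -
      let ?d = "x n $ j - x n $ i"
      have "\<delta> / 2 * ?d \<le> ?d * ?d" using gap[OF that] \<delta> by (intro mult_right_mono) auto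
      then have d: "?d \<le> 2 / \<delta> * ?d\<^sup>2" using \<delta> by (simp add: field_simps power2_eq_square)
      have "(x n $ i - x n $ j)\<^sup>2 = ?d\<^sup>2" by (simp add: power2_commute)
      moreover have "a * ?d \<le> 2 / \<delta> * (a * ?d\<^sup>2)" if "0 \<le> a" for a
        using mult_left_mono[OF d that] by (simp add: algebra_simps)
      ultimately show ?thesis using row_stochastic_nonneg[OF A] by simp
    qed
    have step: "D (Suc n) = D n + 2 / \<delta> * disagreement (A n) (x n)"
      by (simp add: D_def algebra_simps)
    show ?case
    proof (intro conjI ballI)
      fix i assume i: "i \<in> S"
      have "x (Suc n) $ i \<le> (\<theta> + D n) + (\<Sum>j\<in>-S. A n $ i $ j * (x n $ j - x n $ i))"
        unfolding x using A i Suc by (intro row_stochastic_upper_bound) auto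
      also have "(\<Sum>j\<in>-S. A n $ i $ j * (x n $ j - x n $ i)) \<le>
          (\<Sum>j\<in>-S. 2 / \<delta> * (A n $ i $ j * (x n $ i - x n $ j)\<^sup>2))"
        using cross i by (intro sum_mono) auto
      also have "\<dots> \<le> 2 / \<delta> * disagreement (A n) (x n)"
        unfolding sum_distrib_left[symmetric]
        using \<delta> A by (intro mult_left_mono disagreement_ge_partial_row) auto
      finally show "x (Suc n) $ i \<le> \<theta> + D (Suc n)" by (simp add: step)
    next
      fix i assume i: "i \<in> -S"
      have "(\<Sum>j\<in>S. A n $ i $ j * (x n $ i - x n $ j)) \<le>
          (\<Sum>j\<in>S. 2 / \<delta> * (A n $ i $ j * (x n $ i - x n $ j)\<^sup>2))"
        using cross i by (intro sum_mono) auto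
      also have "\<dots> \<le> 2 / \<delta> * disagreement (A n) (x n)"
        unfolding sum_distrib_left[symmetric]
        using \<delta> A by (intro mult_left_mono disagreement_ge_partial_row) auto
      finally have "(\<Sum>j\<in>S. A n $ i $ j * (x n $ i - x n $ j)) \<le> 2 / \<delta> * disagreement (A n) (x n)" .
      moreover have "(\<Sum>j\<in>- (- S). A n $ i $ j * (x n $ j - x n $ i)) =
          - (\<Sum>j\<in>S. A n $ i $ j * (x n $ i - x n $ j))"
        by (simp add: sum_negf[symmetric] right_diff_distrib)
      moreover have "(\<theta> + \<delta> - D n) + (\<Sum>j\<in>- (- S). A n $ i $ j * (x n $ j - x n $ i)) \<le> x (Suc n) $ i"
        unfolding x using A i Suc by (intro row_stochastic_lower_bound) auto
      ultimately show "\<theta> + \<delta> - D (Suc n) \<le> x (Suc n) $ i" by (simp add: step)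
    qed
  qed
  then have "x n $ i \<le> \<theta> + D n" using i by blast
  then show ?thesis using D[of n] by linarith
qed

text \<open>Pigeonhole: \<open>CARD('n) + 1\<close> disjoint open intervals of length \<delta> are
  stacked above \<open>v\<close>, so one of them contains no coordinate of \<open>y\<close>. Its
  lower end is \<theta>.\<close>

lemma exists_gap_above:
  fixes y :: "real^'n" and v \<delta> :: real
  assumes \<delta>: "0 < \<delta>"
  obtains \<theta> where "v \<le> \<theta>" "\<theta> \<le> v + CARD('n) * \<delta>" "\<And>i. y $ i \<le> \<theta> \<or> \<theta> + \<delta> \<le> y $ i"
proof -
  have "\<exists>p\<le>CARD('n). \<forall>i. y $ i \<le> v + real p * \<delta> \<or> v + real p * \<delta> + \<delta> \<le> y $ i"
  proof (rule ccontr)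
    assume "\<not> ?thesis"
    then have "\<forall>p\<le>CARD('n). \<exists>i. v + real p * \<delta> < y $ i \<and> y $ i < v + real p * \<delta> + \<delta>"
      by (meson not_le)
    then obtain f where f: "\<And>p. p \<le> CARD('n) \<Longrightarrow>
        v + real p * \<delta> < y $ f p \<and> y $ f p < v + real p * \<delta> + \<delta>"
      by metis
    have ne: "f p \<noteq> f q" if "p < q" "q \<le> CARD('n)" for p q
    proof -
      have "real p + 1 \<le> real q" using that by linarith
      then have "(real p + 1) * \<delta> \<le> real q * \<delta>" using \<delta> by (intro mult_right_mono) auto
      then show ?thesis using f[of p] f[of q] that by (auto simp: algebra_simps)
    qed
    then have "inj_on f {..CARD('n)}"
      by (intro inj_onI) (metis atMost_iff linorder_neqE_nat)
    then have "card {..CARD('n)} \<le> CARD('n)" by (intro card_inj_on_le) auto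
    then show False by simp
  qed
  then obtain p where p: "p \<le> CARD('n)" "\<And>i. y $ i \<le> v + real p * \<delta> \<or> v + real p * \<delta> + \<delta> \<le> y $ i"
    by auto
  show thesis
    by (rule that[of "v + real p * \<delta>"]) (use p \<delta> in \<open>auto intro!: mult_right_mono\<close>)
qed

text \<open>Some gap of width \<delta> starts at most \<open>CARD('n) * \<delta>\<close> above
  \<open>x 0 $ i\<close>. It persists for the set of agents below it, to which \<open>i\<close>
  belongs; the extra \<delta> in the bound covers the intrusion of \<open>\<delta> / 8\<close> into
  the gap.\<close>

lemma trajectory_rise_bound:
  fixes x :: "nat \<Rightarrow> real^'n" and \<delta> :: real
  assumes A: "\<And>k. row_stochastic (A k)" and x: "\<And>k. x (Suc k) = A k *v x k"
    and \<delta>: "0 < \<delta>" and small: "\<And>n. (\<Sum>k<n. disagreement (A k) (x k)) \<le> \<delta>\<^sup>2 / 16"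
  shows "x n $ i \<le> x 0 $ i + (CARD('n) + 1) * \<delta>"
proof -
  obtain \<theta> where \<theta>: "x 0 $ i \<le> \<theta>" "\<theta> \<le> x 0 $ i + CARD('n) * \<delta>"
      "\<And>j. x 0 $ j \<le> \<theta> \<or> \<theta> + \<delta> \<le> x 0 $ j"
    using exists_gap_above[OF \<delta>, of "x 0 $ i" "x 0"] by blast
  have "x n $ i \<le> \<theta> + \<delta> / 8"
    by (rule gap_persists[where S = "{j. x 0 $ j \<le> \<theta>}", OF A x \<delta> _ _ small])
       (use \<theta> in \<open>auto\<close>)
  then show ?thesis using \<theta>(2) \<delta> by (simp add: algebra_simps)
qed

text \<open>A fall is a rise of the negated trajectory, which obeys the same recursion and has the
  same disagreement.\<close>

lemma trajectory_variation_bound: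
  fixes x :: "nat \<Rightarrow> real^'n" and \<delta> :: real
  assumes A: "\<And>k. row_stochastic (A k)" and x: "\<And>k. x (Suc k) = A k *v x k"
    and \<delta>: "0 < \<delta>" and small: "\<And>n. (\<Sum>k<n. disagreement (A k) (x k)) \<le> \<delta>\<^sup>2 / 16"
  shows "\<bar>x n $ i - x 0 $ i\<bar> \<le> (CARD('n) + 1) * \<delta>"
proof -
  have "- x (Suc k) = A k *v - x k" for k
    by (simp add: x vec_eq_iff matrix_vector_mult_def sum_negf)
  then have "(- x n) $ i \<le> (- x 0) $ i + (CARD('n) + 1) * \<delta>"
    using small by (intro trajectory_rise_bound[where A = A and x = "\<lambda>k. - x k"] A \<delta>)
      (auto simp: disagreement_uminus)
  then show ?thesis
    using trajectory_rise_bound[OF A x \<delta> small, of n i] by (simp add: abs_le_iff)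
qed

lemma convergent_of_summable_disagreement:
  fixes x :: "nat \<Rightarrow> real^'n"
  assumes A: "\<And>k. row_stochastic (A k)" and x: "\<And>k. x (Suc k) = A k *v x k"
    and summ: "summable (\<lambda>k. disagreement (A k) (x k))"
  shows "convergent (\<lambda>k. x k $ i)"
proof -
  have "Cauchy (\<lambda>k. x k $ i)"
  proof (rule metric_CauchyI)
    fix e :: real assume e: "0 < e"
    \<comment> \<open>With this choice every value after time \<open>K\<close> is within
      \<open>e / 4\<close> of the value at \<open>K\<close>, so any two of them differ by at most
      \<open>e / 2\<close>.\<close>
    define \<delta> where "\<delta> = e / (4 * (CARD('n) + 1))"
    have \<delta>: "0 < \<delta>" using e by (simp add: \<delta>_def add_pos_nonneg)
    have \<delta>e: "(CARD('n) + 1) * \<delta> = e / 4" by (simp add: \<delta>_def field_simps)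
    from \<delta> have "0 < \<delta>\<^sup>2 / 16" by simp
    from suminf_exist_split[OF this summ]
    obtain K where K: "\<And>n. n \<ge> K \<Longrightarrow> norm (\<Sum>k. disagreement (A (k + n)) (x (k + n))) < \<delta>\<^sup>2 / 16"
      by auto
    have small: "(\<Sum>k<n. disagreement (A (k + K)) (x (k + K))) \<le> \<delta>\<^sup>2 / 16" for n
    proof -
      have "(\<Sum>k<n. disagreement (A (k + K)) (x (k + K))) \<le> (\<Sum>k. disagreement (A (k + K)) (x (k + K)))"
        by (intro sum_le_suminf summable_ignore_initial_segment[OF summ])
           (auto simp: disagreement_nonneg A)
      also have "\<dots> \<le> \<delta>\<^sup>2 / 16" using K[of K] by simp
      finally show ?thesis .
    qed
    have "\<bar>x (n + K) $ i - x (0 + K) $ i\<bar> \<le> (CARD('n) + 1) * \<delta>" for n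
      by (rule trajectory_variation_bound[where A = "\<lambda>k. A (k + K)" and x = "\<lambda>k. x (k + K)"])
         (use A x \<delta> small in auto)
    then have near: "\<bar>x n $ i - x K $ i\<bar> \<le> e / 4" if "n \<ge> K" for n
      using that \<delta>e by (metis add.commute add_0 le_Suc_ex)
    have "dist (x m $ i) (x n $ i) < e" if "m \<ge> K" "n \<ge> K" for m n
      using near[OF that(1)] near[OF that(2)] e unfolding dist_real_def by linarith
    then show "\<exists>K. \<forall>m\<ge>K. \<forall>n\<ge>K. dist (x m $ i) (x n $ i) < e" by blast
  qed
  then show ?thesis by (rule Cauchy_convergent)
qed

lemma filterlim_sum_at_top_comparison:
  fixes f g :: "nat \<Rightarrow> real"
  assumes "filterlim (\<lambda>n. \<Sum>k<n. f k) at_top sequentially"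
    and "\<And>k. k \<ge> K \<Longrightarrow> f k \<le> g k" and "\<And>k. 0 \<le> g k"
  shows "\<not> summable g"
proof
  assume "summable g"
  then have s: "summable (\<lambda>k. g (k + K))" by (rule summable_ignore_initial_segment)
  \<comment> \<open>The sign of \<open>f\<close> is arbitrary and \<open>g\<close> dominates it only
    from \<open>K\<close> on, so the first \<open>K\<close> terms enter with absolute
    values.\<close>
  have "(\<Sum>k<n. f k) \<le> (\<Sum>k<K. \<bar>f k\<bar>) + suminf g" for n
  proof -
    have "(\<Sum>k<n. f k) \<le> (\<Sum>k<n. (if k < K then \<bar>f k\<bar> else 0) + g k)"
      using assms(2,3) by (intro sum_mono) (smt (verit) not_less)
    also have "\<dots> = (\<Sum>k\<in>{..<n} \<inter> {..<K}. \<bar>f k\<bar>) + (\<Sum>k<n. g k)"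
      by (simp add: sum.distrib sum.inter_restrict)
    also have "(\<Sum>k\<in>{..<n} \<inter> {..<K}. \<bar>f k\<bar>) \<le> (\<Sum>k<K. \<bar>f k\<bar>)" by (intro sum_mono2) auto
    also have "(\<Sum>k<n. g k) \<le> suminf g"
      using assms(3) \<open>summable g\<close> by (intro sum_le_suminf) auto
    finally show ?thesis by simp
  qed
  moreover obtain n where "(\<Sum>k<K. \<bar>f k\<bar>) + suminf g < (\<Sum>k<n. f k)"
    using assms(1) by (metis (no_types, lifting) eventually_sequentially filterlim_at_top_dense order_refl)
  ultimately show False by (simp add: not_less[symmetric])
qed

text \<open>
  If the difference did not tend to \<open>0\<close>, the flow between \<open>i\<close> and \<open>j\<close> would be bounded by a
  multiple of the total disagreement.
\<close>

lemma difference_tendsto_zero: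
  fixes x :: "nat \<Rightarrow> real^'n"
  assumes A: "\<And>k. row_stochastic (A k)" and x: "\<And>k. x (Suc k) = A k *v x k"
    and summ: "summable (\<lambda>k. disagreement (A k) (x k))"
    and flow: "filterlim (\<lambda>n. \<Sum>k<n. A k $ i $ j + A k $ j $ i) at_top sequentially"
  shows "(\<lambda>k. x k $ i - x k $ j) \<longlonglongrightarrow> 0"
proof -
  have "convergent (\<lambda>k. x k $ i - x k $ j)"
    using convergent_of_summable_disagreement[OF A x summ] by (intro convergent_diff)
  then obtain L where L: "(\<lambda>k. x k $ i - x k $ j) \<longlonglongrightarrow> L"
    by (auto simp: convergent_def)
  have "L = 0"
  proof (rule ccontr)
    assume "L \<noteq> 0"
    have "(\<lambda>k. (x k $ i - x k $ j)\<^sup>2) \<longlonglongrightarrow> L\<^sup>2" using L by (intro tendsto_intros)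
    moreover have "L\<^sup>2 / 2 < L\<^sup>2" using \<open>L \<noteq> 0\<close> by simp
    ultimately have "eventually (\<lambda>k. L\<^sup>2 / 2 < (x k $ i - x k $ j)\<^sup>2) sequentially"
      by (rule order_tendstoD)
    then obtain K where K: "\<And>k. k \<ge> K \<Longrightarrow> L\<^sup>2 / 2 < (x k $ i - x k $ j)\<^sup>2"
      by (auto simp: eventually_sequentially)
    \<comment> \<open>From \<open>K\<close> on, a unit of flow costs at least
      \<open>L\<^sup>2 / 2\<close> of disagreement. Each of the two directions is bounded separately
      by the whole disagreement, which doubles the constant to \<open>4 / L\<^sup>2\<close>.\<close>
    have "A k $ i $ j + A k $ j $ i \<le> 4 / L\<^sup>2 * disagreement (A k) (x k)" if "k \<ge> K" for k
    proof -
      have p: "A k $ i $ j * (x k $ i - x k $ j)\<^sup>2 \<le> disagreement (A k) (x k)" for i j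
        using disagreement_ge_partial_row[OF A, where T = "{j}"] by simp
      have "(A k $ i $ j + A k $ j $ i) * (L\<^sup>2 / 2) \<le> (A k $ i $ j + A k $ j $ i) * (x k $ i - x k $ j)\<^sup>2"
        using K[OF that] row_stochastic_nonneg[OF A] by (intro mult_left_mono) (auto intro: add_nonneg_nonneg)
      also have "\<dots> \<le> 2 * disagreement (A k) (x k)"
        using p[of i j] p[of j i] by (simp add: algebra_simps power2_commute[of "x k $ j"])
      finally show ?thesis using \<open>L \<noteq> 0\<close> by (simp add: field_simps)
    qed
    then have "\<not> summable (\<lambda>k. 4 / L\<^sup>2 * disagreement (A k) (x k))"
      by (intro filterlim_sum_at_top_comparison[OF flow]) (auto simp: disagreement_nonneg A)
    then show False using summ by (simp add: summable_mult)
  qed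
  with L show ?thesis by simp
qed

section \<open>Transition matrices: from basis vectors to all trajectories\<close>

primrec chain_prod :: "(nat \<Rightarrow> real^'n^'n) \<Rightarrow> nat \<Rightarrow> real^'n^'n" where
  "chain_prod A 0 = mat 1"
| "chain_prod A (Suc n) = A n ** chain_prod A n"

lemma chain_prod_cong: "(\<And>k. k < n \<Longrightarrow> A k = B k) \<Longrightarrow> chain_prod A n = chain_prod B n"
proof (induction n)
  case (Suc n)
  then have "A n = B n" "chain_prod A n = chain_prod B n" by (blast intro: less_SucI)+
  then show ?case by simp
qed simp

lemma trajectory_chain_prod:
  assumes "trajectory A t0 x"
  shows "x (t0 + n) = chain_prod (\<lambda>k. A (t0 + k)) n *v x t0"
  using assms by (induction n) (auto simp: trajectory_def matrix_vector_mul_assoc)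

lemma chain_prod_axis_nth: "(chain_prod A n *v axis l 1) $ i = chain_prod A n $ i $ l"
  by (simp add: matrix_vector_mult_def axis_def if_distrib cong: if_cong)

lemma trajectory_nth:
  assumes "trajectory A t0 x"
  shows "x (t0 + n) $ i = (\<Sum>l\<in>UNIV. chain_prod (\<lambda>k. A (t0 + k)) n $ i $ l * x t0 $ l)"
  unfolding trajectory_chain_prod[OF assms] by (simp add: matrix_vector_mult_def)

lemma LIMSEQ_offset_nat: "(\<lambda>n. f (t + n)) \<longlonglongrightarrow> l \<Longrightarrow> f \<longlonglongrightarrow> l"
  by (rule LIMSEQ_offset[of _ t]) (simp add: add.commute)

text \<open>Only basis vectors are used as initial states, so there are countably many conditions,
  and each may be proved almost surely on its own. Arbitrary initial states are recovered by
  linearity.\<close>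

definition summable_disagreement :: "(nat \<Rightarrow> real^'n^'n) \<Rightarrow> bool" where
  "summable_disagreement A \<longleftrightarrow> (\<forall>t0 l. summable (\<lambda>k.
     disagreement (A (t0 + k)) (chain_prod (\<lambda>k. A (t0 + k)) k *v axis l 1)))"

text \<open>The trajectory started from \<open>axis l 1\<close> is column \<open>l\<close> of the
  transition matrix. All entries of that matrix thus converge, and a coordinate of any trajectory is
  a fixed linear combination of them.\<close>

lemma stable_of_summable_disagreement:
  assumes A: "\<And>k. row_stochastic (A k)" and "summable_disagreement A"
  shows "stable_chain A"
  unfolding stable_chain_def ergodic_index_def
proof (intro allI impI)
  fix i t0 x assume x: "trajectory A t0 x"
  let ?P = "chain_prod (\<lambda>k. A (t0 + k))"
  have "convergent (\<lambda>n. (?P n *v axis l 1) $ i)" for l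
    using assms by (intro convergent_of_summable_disagreement[where A = "\<lambda>k. A (t0 + k)"])
      (auto simp: summable_disagreement_def matrix_vector_mul_assoc)
  then have "\<exists>L. (\<lambda>n. ?P n $ i $ l) \<longlonglongrightarrow> L" for l
    by (simp add: chain_prod_axis_nth convergent_def)
  then obtain L where "\<And>l. (\<lambda>n. ?P n $ i $ l) \<longlonglongrightarrow> L l" by metis
  then have "(\<lambda>n. x (t0 + n) $ i) \<longlonglongrightarrow> (\<Sum>l\<in>UNIV. L l * x t0 $ l)"
    unfolding trajectory_nth[OF x] by (intro tendsto_intros)
  then have "(\<lambda>n. x n $ i) \<longlonglongrightarrow> (\<Sum>l\<in>UNIV. L l * x t0 $ l)"
    by (rule LIMSEQ_offset_nat)
  then show "convergent (\<lambda>k. x k $ i)" by (auto simp: convergent_def)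
qed

lemma filterlim_sum_shift_at_top:
  fixes f :: "nat \<Rightarrow> real"
  assumes "filterlim (\<lambda>n. \<Sum>k<n. f k) at_top sequentially"
  shows "filterlim (\<lambda>n. \<Sum>k<n. f (t + k)) at_top sequentially"
proof -
  have "filterlim (\<lambda>n. \<Sum>k<n + t. f k) at_top sequentially"
    by (rule filterlim_compose[OF assms filterlim_add_const_nat_at_top])
  then have "filterlim (\<lambda>n. - (\<Sum>k<t. f k) + (\<Sum>k<n + t. f k)) at_top sequentially"
    by (intro filterlim_tendsto_add_at_top[OF tendsto_const])
  moreover have "(\<Sum>k<n + t. f k) = (\<Sum>k<t. f k) + (\<Sum>k<n. f (t + k))" for n
    by (induction n) (auto simp: add.commute)
  ultimately show ?thesis by simp
qed

lemma weakly_ergodic_of_infinite_flow: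
  assumes A: "\<And>k. row_stochastic (A k)" and "summable_disagreement A"
    and flow: "filterlim (\<lambda>n. \<Sum>k<n. A k $ i $ j + A k $ j $ i) at_top sequentially"
  shows "mutually_weakly_ergodic A i j"
  unfolding mutually_weakly_ergodic_def
proof (intro allI impI)
  fix t0 x assume x: "trajectory A t0 x"
  let ?P = "chain_prod (\<lambda>k. A (t0 + k))"
  have "(\<lambda>n. (?P n *v axis l 1) $ i - (?P n *v axis l 1) $ j) \<longlonglongrightarrow> 0" for l
    using assms by (intro difference_tendsto_zero[where A = "\<lambda>k. A (t0 + k)"] filterlim_sum_shift_at_top[OF flow])
      (auto simp: summable_disagreement_def matrix_vector_mul_assoc)
  then have "(\<lambda>n. \<Sum>l\<in>UNIV. (?P n $ i $ l - ?P n $ j $ l) * x t0 $ l) \<longlonglongrightarrow> (\<Sum>l\<in>UNIV. 0 * x t0 $ l)"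
    unfolding chain_prod_axis_nth by (intro tendsto_intros)
  then have "(\<lambda>n. x (t0 + n) $ i - x (t0 + n) $ j) \<longlonglongrightarrow> 0"
    unfolding trajectory_nth[OF x] by (simp add: sum_subtractf[symmetric] algebra_simps)
  then show "(\<lambda>n. x n $ i - x n $ j) \<longlonglongrightarrow> 0"
    by (rule LIMSEQ_offset_nat)
qed

section \<open>Weak ergodicity as an equivalence, and flow across a cut\<close>

lemma mutually_weakly_ergodic_refl: "mutually_weakly_ergodic A i i"
  by (simp add: mutually_weakly_ergodic_def)

lemma mutually_weakly_ergodic_sym:
  "mutually_weakly_ergodic A i j \<Longrightarrow> mutually_weakly_ergodic A j i"
  using tendsto_minus[where a = "0 :: real"] unfolding mutually_weakly_ergodic_def by force

lemma mutually_weakly_ergodic_trans: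
  assumes "mutually_weakly_ergodic A i j" "mutually_weakly_ergodic A j l"
  shows "mutually_weakly_ergodic A i l"
  unfolding mutually_weakly_ergodic_def
proof (intro allI impI)
  fix t0 x assume "trajectory A t0 x"
  then have "(\<lambda>k. (x k $ i - x k $ j) + (x k $ j - x k $ l)) \<longlonglongrightarrow> 0 + 0"
    using assms unfolding mutually_weakly_ergodic_def by (intro tendsto_add) auto
  then show "(\<lambda>k. x k $ i - x k $ l) \<longlonglongrightarrow> 0" by simp
qed

definition cut_flow :: "real^'n^'n \<Rightarrow> 'n set \<Rightarrow> real" where
  "cut_flow A S = (\<Sum>u\<in>S. \<Sum>v\<in>-S. A $ u $ v + A $ v $ u)"

lemma cut_flow_partial_row_le:
  assumes A: "row_stochastic A"
  shows "i \<in> S \<Longrightarrow> (\<Sum>j\<in>-S. A $ i $ j) \<le> cut_flow A S"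
    and "i \<in> -S \<Longrightarrow> (\<Sum>j\<in>S. A $ i $ j) \<le> cut_flow A S"
proof -
  have nn: "0 \<le> A $ u $ v" for u v using A by (rule row_stochastic_nonneg)
  { assume "i \<in> S"
    have "(\<Sum>j\<in>-S. A $ i $ j) \<le> (\<Sum>j\<in>-S. A $ i $ j + A $ j $ i)"
      by (intro sum_mono) (simp add: nn)
    also have "\<dots> \<le> cut_flow A S"
      unfolding cut_flow_def using \<open>i \<in> S\<close> by (intro member_le_sum) (auto intro!: sum_nonneg add_nonneg_nonneg nn)
    finally show "(\<Sum>j\<in>-S. A $ i $ j) \<le> cut_flow A S" . }
  { assume "i \<in> -S"
    have "(\<Sum>j\<in>S. A $ i $ j) \<le> (\<Sum>j\<in>S. A $ j $ i + A $ i $ j)"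
      by (intro sum_mono) (simp add: nn)
    also have "\<dots> \<le> (\<Sum>v\<in>-S. \<Sum>j\<in>S. A $ j $ v + A $ v $ j)"
      using \<open>i \<in> -S\<close> by (intro member_le_sum) (auto intro!: sum_nonneg add_nonneg_nonneg nn)
    also have "\<dots> = cut_flow A S" unfolding cut_flow_def by (rule sum.swap)
    finally show "(\<Sum>j\<in>S. A $ i $ j) \<le> cut_flow A S" . }
qed

lemma row_stochastic_mult_in_unit:
  assumes A: "row_stochastic A" and "\<And>i. 0 \<le> x $ i" "\<And>i. x $ i \<le> 1"
  shows "0 \<le> (A *v x) $ i" "(A *v x) $ i \<le> 1"
  using row_stochastic_lower_bound[OF A, of i UNIV 0 x] row_stochastic_upper_bound[OF A, of i UNIV x 1] assms
  by auto

text \<open>Started from the indicator of \<open>S\<close>, the values on the two sides of the cut approach each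
  other by at most the flow across the cut.\<close>

lemma cut_flow_of_weakly_ergodic:
  fixes A :: "nat \<Rightarrow> real^'n^'n"
  assumes A: "\<And>k. row_stochastic (A k)" and mwe: "mutually_weakly_ergodic A i j"
    and i: "i \<in> S" and j: "j \<notin> S"
  shows "\<exists>n. 1 / 4 < (\<Sum>k<n. cut_flow (A (t0 + k)) S)"
proof (rule ccontr)
  assume neg: "\<not> ?thesis"
  define z :: "real^'n" where "z = (\<chi> l. if l \<in> S then 1 else 0)"
  define y where "y n = chain_prod (\<lambda>k. A (t0 + k)) n *v z" for n
  define F where "F n = (\<Sum>k<n. cut_flow (A (t0 + k)) S)" for n
  have y_Suc: "y (Suc n) = A (t0 + n) *v y n" for n by (simp add: y_def matrix_vector_mul_assoc)
  \<comment> \<open>Values in the unit interval differ by at most 1, so the change caused by the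
    other side is bounded by the crossing weights alone.\<close>
  have unit: "0 \<le> y n $ l \<and> y n $ l \<le> 1" for n l
  proof (induction n arbitrary: l)
    case 0
    show ?case by (simp add: y_def z_def)
  next
    case (Suc n)
    then show ?case
      unfolding y_Suc using row_stochastic_mult_in_unit[OF A] by blast
  qed
  have sum_le: "\<bar>\<Sum>v\<in>T. A k $ l $ v * (y n $ v - y n $ l)\<bar> \<le> (\<Sum>v\<in>T. A k $ l $ v)" for T k l n
  proof -
    have "\<bar>\<Sum>v\<in>T. A k $ l $ v * (y n $ v - y n $ l)\<bar> \<le> (\<Sum>v\<in>T. \<bar>A k $ l $ v * (y n $ v - y n $ l)\<bar>)"
      by (rule sum_abs)
    also have "\<dots> \<le> (\<Sum>v\<in>T. A k $ l $ v * 1)"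
      unfolding abs_mult using row_stochastic_nonneg[OF A]
    proof (intro sum_mono mult_mono)
      show "\<bar>y n $ v - y n $ l\<bar> \<le> 1" for v using unit[of n v] unit[of n l] by linarith
    qed auto
    finally show ?thesis by simp
  qed
  have inv: "(\<forall>l\<in>S. 1 - F n \<le> y n $ l) \<and> (\<forall>l\<in>-S. y n $ l \<le> F n)" for n
  proof (induction n)
    case 0
    show ?case by (simp add: F_def y_def z_def)
  next
    case (Suc n)
    have F_Suc: "F (Suc n) = F n + cut_flow (A (t0 + n)) S" by (simp add: F_def)
    have "1 - F (Suc n) \<le> y (Suc n) $ l" if "l \<in> S" for l
    proof -
      have "(1 - F n) + (\<Sum>v\<in>-S. A (t0 + n) $ l $ v * (y n $ v - y n $ l)) \<le> y (Suc n) $ l"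
        unfolding y_Suc using A that Suc by (intro row_stochastic_lower_bound) auto
      moreover have "(\<Sum>v\<in>-S. A (t0 + n) $ l $ v) \<le> cut_flow (A (t0 + n)) S"
        using cut_flow_partial_row_le(1)[OF A that] .
      ultimately show ?thesis using sum_le[of "t0 + n" l n "-S"] by (simp add: F_Suc)
    qed
    moreover have "y (Suc n) $ l \<le> F (Suc n)" if "l \<in> -S" for l
    proof -
      have "y (Suc n) $ l \<le> F n + (\<Sum>v\<in>- (- S). A (t0 + n) $ l $ v * (y n $ v - y n $ l))"
        unfolding y_Suc using A that Suc by (intro row_stochastic_upper_bound) auto
      moreover have "(\<Sum>v\<in>S. A (t0 + n) $ l $ v) \<le> cut_flow (A (t0 + n)) S"
        using cut_flow_partial_row_le(2)[OF A that] .
      ultimately show ?thesis using sum_le[of "t0 + n" l n S] by (simp add: F_Suc)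
    qed
    ultimately show ?case by blast
  qed
  \<comment> \<open>Truncated subtraction gives the value \<open>y 0\<close> at all times before
    \<open>t0\<close>, which \<open>trajectory\<close> leaves unconstrained.\<close>
  have "trajectory A t0 (\<lambda>k. y (k - t0))"
    by (simp add: trajectory_def Suc_diff_le y_Suc)
  then have "(\<lambda>k. y (k - t0) $ i - y (k - t0) $ j) \<longlonglongrightarrow> 0"
    using mwe unfolding mutually_weakly_ergodic_def by blast
  moreover have "1 / 2 \<le> y n $ i - y n $ j" for n
  proof -
    have "F n \<le> 1 / 4" using neg by (auto simp: F_def not_less)
    moreover have "1 - F n \<le> y n $ i" "y n $ j \<le> F n" using inv i j by auto
    ultimately show ?thesis by linarith
  qed
  ultimately have "1 / 2 \<le> (0 :: real)"
    by (intro LIMSEQ_le_const) auto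
  then show False by simp
qed

subsection \<open>The broadcast gossip model\<close>

lemma borel_measurable_vec_nth [measurable]: "(\<lambda>x :: 'a::real_normed_vector^'n. x $ i) \<in> borel_measurable borel"
  by (intro borel_measurable_continuous_onI continuous_intros)

section \<open>Algebra of a single broadcast\<close>

lemma outer_product_nth:
  "((columnvector u :: real^1^'m) ** (rowvector w :: real^'n^1)) $ a $ b = u $ a * w $ b"
  by (simp add: matrix_matrix_mult_def columnvector_def rowvector_def)

lemma broadcast_matrix_nth:
  "broadcast_matrix G c i $ a $ b = (if a = b then 1 else 0) -
     (if a \<in> neighbours G i then c * ((if a = b then 1 else 0) - (if i = b then 1 else 0)) else 0)"
proof -
  have "(\<Sum>j\<in>neighbours G i. basis_vec j $ a * (basis_vec j - basis_vec i) $ b) =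
      (\<Sum>j\<in>neighbours G i. if a = j then (if a = b then 1 else 0) - (if i = b then 1 else 0) else 0)"
    by (intro sum.cong refl) (auto simp: basis_vec_def axis_def)
  also have "\<dots> = (if a \<in> neighbours G i then (if a = b then 1 else 0) - (if i = b then 1 else 0) else 0)"
    by (simp add: sum.delta')
  finally show ?thesis
    by (simp add: broadcast_matrix_def outer_product_nth sum_component mat_def)
qed

lemma row_stochastic_broadcast_matrix:
  assumes "0 \<le> c" "c \<le> 1"
  shows "row_stochastic (broadcast_matrix G c i)"
proof -
  have "(\<Sum>b\<in>UNIV. broadcast_matrix G c i $ a $ b) = 1" for a
    by (cases "a \<in> neighbours G i")
       (simp_all add: broadcast_matrix_nth sum_subtractf flip: sum_distrib_left)
  then show ?thesis using assms by (auto simp: row_stochastic_def broadcast_matrix_nth)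
qed

lemma broadcast_matrix_mult_nth:
  assumes "0 \<le> c" "c \<le> 1"
  shows "(broadcast_matrix G c i *v x) $ a = x $ a - (if a \<in> neighbours G i then c * (x $ a - x $ i) else 0)"
proof -
  have "(\<Sum>b\<in>UNIV. broadcast_matrix G c i $ a $ b * (x $ b - x $ a)) =
      (\<Sum>b\<in>UNIV. if i = b then (if a \<in> neighbours G i then c * (x $ i - x $ a) else 0) else 0)"
    by (intro sum.cong refl) (auto simp: broadcast_matrix_nth)
  then show ?thesis
    using row_stochastic_mult_nth[OF row_stochastic_broadcast_matrix[OF assms], of G i x a]
    by (simp add: algebra_simps)
qed

lemma disagreement_broadcast_matrix:
  "disagreement (broadcast_matrix G c i) x =
     (\<Sum>a\<in>UNIV. if a \<in> neighbours G i then c * (x $ a - x $ i)\<^sup>2 else 0)"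
proof -
  have "(\<Sum>b\<in>UNIV. broadcast_matrix G c i $ a $ b * (x $ a - x $ b)\<^sup>2) =
      (\<Sum>b\<in>UNIV. if i = b then (if a \<in> neighbours G i then c * (x $ a - x $ i)\<^sup>2 else 0) else 0)" for a
    by (intro sum.cong refl) (auto simp: broadcast_matrix_nth)
  then show ?thesis by (simp add: disagreement_def)
qed

text \<open>For a neighbour \<open>a\<close> of the waking agent \<open>i\<close>, put d = x_a -
  x_i. Then (x_a - c d)^2 + (1 - c) c d^2 = x_a^2 + c x_i^2 - c x_a^2. Summed over all ordered pairs
  of neighbours, the last two terms cancel because adjacency is symmetric. After division by the
  number of agents, the mean energy loss is exactly \<open>1 - c\<close> times the mean
  disagreement.\<close>

lemma broadcast_energy_balance:
  fixes x :: "real^'m"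
  assumes sym: "symmetric (with_proj G)" and c: "0 \<le> c" "c \<le> 1"
  shows "(\<Sum>i\<in>UNIV. (\<Sum>a\<in>UNIV. ((broadcast_matrix G c i *v x) $ a)\<^sup>2) +
      (1 - c) * disagreement (broadcast_matrix G c i) x) = CARD('m) * (\<Sum>a\<in>UNIV. (x $ a)\<^sup>2)"
proof -
  have nb: "a \<in> neighbours G i \<longleftrightarrow> i \<in> neighbours G a" for a i
    using sym by (auto simp: neighbours_def symmetric_def sym_def)
  let ?t = "\<lambda>i a. if a \<in> neighbours G i then c * (x $ i)\<^sup>2 else 0"
  let ?s = "\<lambda>i a. if a \<in> neighbours G i then c * (x $ a)\<^sup>2 else 0"
  have "(\<Sum>i\<in>UNIV. (\<Sum>a\<in>UNIV. ((broadcast_matrix G c i *v x) $ a)\<^sup>2) +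
      (1 - c) * disagreement (broadcast_matrix G c i) x) =
      (\<Sum>i\<in>UNIV. \<Sum>a\<in>UNIV. (x $ a)\<^sup>2 + ?t i a - ?s i a)"
    unfolding disagreement_broadcast_matrix sum_distrib_left broadcast_matrix_mult_nth[OF c]
      sum.distrib[symmetric]
    by (intro sum.cong refl) (simp add: power2_eq_square algebra_simps)
  also have "\<dots> = CARD('m) * (\<Sum>a\<in>UNIV. (x $ a)\<^sup>2) + (\<Sum>i\<in>UNIV. \<Sum>a\<in>UNIV. ?t i a)
      - (\<Sum>i\<in>UNIV. \<Sum>a\<in>UNIV. ?s i a)"
    by (simp add: sum.distrib sum_subtractf)
  also have "(\<Sum>i\<in>UNIV. \<Sum>a\<in>UNIV. ?s i a) = (\<Sum>i\<in>UNIV. \<Sum>a\<in>UNIV. ?t i a)"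
    by (subst sum.swap) (simp add: nb)
  finally show ?thesis by simp
qed

definition edge_weight :: "'m pair_pre_digraph \<Rightarrow> real \<Rightarrow> 'm \<Rightarrow> 'm \<Rightarrow> real" where
  "edge_weight G c u v = (if (u, v) \<in> parcs G then c else 0)"

text \<open>The off-diagonal entry at \<open>(u, v)\<close> is nonzero only if \<open>v\<close>
  wakes and \<open>u\<close> is its neighbour. By symmetry of the graph, the waking of either
  endpoint produces the same weight.\<close>

lemma broadcast_matrix_flow:
  assumes sym: "symmetric (with_proj G)" and "u \<noteq> v"
  shows "broadcast_matrix G c i $ u $ v + broadcast_matrix G c i $ v $ u =
    (if i = u \<or> i = v then edge_weight G c u v else 0)"
  using assms by (auto simp: broadcast_matrix_nth neighbours_def edge_weight_def symmetric_def sym_def)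

text \<open>On the unit interval (1 - c/2)(1 + c) is at least 1, and 1 + c is at most exp c. The
  bound serves to estimate the mean of exp(-flow) in one step.\<close>

lemma exp_minus_le_half: "exp (- c) \<le> 1 - c / 2" if "0 \<le> c" "c \<le> 1" for c :: real
proof -
  have "c * c \<le> 1 * c" using that by (intro mult_right_mono) auto
  then have "1 \<le> (1 - c / 2) * (1 + c)" by (simp add: algebra_simps)
  also have "\<dots> \<le> (1 - c / 2) * exp c" using that by (intro mult_left_mono exp_ge_add_one_self) auto
  finally show ?thesis by (simp add: exp_minus field_simps)
qed

text \<open>The index set stays general for two uses: the window itself, where the product is a
  function of the past only, and \<open>UNIV\<close>, where it is a function of the whole
  chain.\<close>

lemma chain_prod_measurable:
  fixes i j :: "'n::finite"
  assumes "{t0..<t0 + n} \<subseteq> I"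
  shows "(\<lambda>f. chain_prod (\<lambda>k. f (t0 + k)) n $ i $ j) \<in> borel_measurable (PiM I (\<lambda>_. borel))"
  using assms
proof (induction n arbitrary: i j)
  case 0
  show ?case by simp
next
  case (Suc n)
  have [measurable]: "(\<lambda>f :: nat \<Rightarrow> real^'n^'n. f (t0 + n)) \<in> measurable (PiM I (\<lambda>_. borel)) borel"
    using Suc.prems by (intro measurable_component_singleton) auto
  have [measurable]: "(\<lambda>f. chain_prod (\<lambda>k. f (t0 + k)) n $ i $ j) \<in> borel_measurable (PiM I (\<lambda>_. borel))" for i j :: 'n
    using Suc.prems by (intro Suc.IH) auto
  show ?case by (simp add: matrix_matrix_mult_def) measurable
qed

section \<open>The random model and its expected energy\<close>

locale broadcast_gossip =
  fixes M :: "'w measure" and G :: "nat \<Rightarrow> 'm::finite pair_pre_digraph"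
    and \<gamma> :: real and \<gamma>s :: "nat \<Rightarrow> real" and W :: "nat \<Rightarrow> 'w \<Rightarrow> real^'m^'m"
  assumes graph: "\<And>k. pair_graph (G k)" and \<gamma>: "\<gamma> < 1"
    and \<gamma>s_pos: "\<And>k. 0 < \<gamma>s k" and \<gamma>s_le: "\<And>k. \<gamma>s k \<le> \<gamma>"
    and model: "broadcast_gossip_model M G \<gamma>s W"

sublocale broadcast_gossip \<subseteq> prob_space M
  using model by (simp add: broadcast_gossip_model_def)

context broadcast_gossip
begin

abbreviation B :: "nat \<Rightarrow> 'm \<Rightarrow> real^'m^'m" where
  "B k \<equiv> broadcast_matrix (G k) (\<gamma>s k)"

lemma sym_G: "symmetric (with_proj (G k))"
  using graph[of k] by (simp add: pair_graph_def pair_pseudo_graph_def pair_sym_digraph_def pair_sym_digraph_axioms_def)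

lemma \<gamma>s_bounds: "0 \<le> \<gamma>s k" "\<gamma>s k \<le> 1"
  using \<gamma> \<gamma>s_pos[of k] \<gamma>s_le[of k] by auto

lemma indep_W: "indep_vars (\<lambda>_. borel) W UNIV"
  using model by (simp add: broadcast_gossip_model_def)

lemma W_measurable [measurable]: "W k \<in> borel_measurable M"
  using indep_W by (simp add: indep_vars_def)

lemma distr_W: "distr M borel (W k) = distr (measure_pmf (pmf_of_set UNIV)) borel (B k)"
  using model by (simp add: broadcast_gossip_model_def)

lemma nn_integral_W:
  assumes f: "f \<in> borel_measurable borel"
  shows "(\<integral>\<^sup>+\<omega>. f (W k \<omega>) \<partial>M) = (\<Sum>i\<in>UNIV. f (B k i)) / of_nat CARD('m)"
proof -
  have "(\<integral>\<^sup>+\<omega>. f (W k \<omega>) \<partial>M) = (\<integral>\<^sup>+w. f w \<partial>distr M borel (W k))"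
    using f by (simp add: nn_integral_distr)
  also have "\<dots> = (\<Sum>i\<in>UNIV. f (B k i)) / of_nat CARD('m)"
    unfolding distr_W using f by (simp add: nn_integral_distr nn_integral_pmf_of_set)
  finally show ?thesis .
qed

text \<open>The model prescribes only the law of \<open>W k\<close>, so a realization is a broadcast
  matrix merely almost surely. The range of \<open>B k\<close> is finite, hence closed and Borel,
  and the property transfers through the common law.\<close>

lemma AE_W_range: "AE \<omega> in M. \<forall>k. \<exists>i. W k \<omega> = B k i"
proof (subst AE_all_countable, intro allI)
  fix k
  have "{w \<in> space borel. \<exists>i. w = B k i} = range (B k)" by auto
  moreover have "range (B k) \<in> sets borel"
    by (intro borel_closed finite_imp_closed) simp
  ultimately have m: "{w \<in> space borel. \<exists>i. w = B k i} \<in> sets borel" by metis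
  have "AE w in distr M borel (W k). \<exists>i. w = B k i"
    unfolding distr_W by (subst AE_distr_iff) (use m in auto)
  then show "AE \<omega> in M. \<exists>i. W k \<omega> = B k i"
    by (subst (asm) AE_distr_iff) (use m in auto)
qed

lemma AE_row_stochastic: "AE \<omega> in M. \<forall>k. row_stochastic (W k \<omega>)"
  using AE_W_range by eventually_elim (metis row_stochastic_broadcast_matrix \<gamma>s_bounds)

text \<open>This replaces conditioning on the past: by independence the joint law is a product, and
  \<open>W k\<close> can be integrated out first. Since \<open>indep_var_restrict\<close> speaks of
  restricted families, \<open>W k\<close> appears as a restriction to \<open>{k}\<close>, and \<psi>
  reads off its coordinate.\<close>

lemma nn_integral_W_past:
  assumes k: "k \<notin> J" and \<phi>: "\<phi> \<in> borel_measurable (borel \<Otimes>\<^sub>M PiM J (\<lambda>_. borel))"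
  shows "(\<integral>\<^sup>+\<omega>. \<phi> (W k \<omega>, restrict (\<lambda>l. W l \<omega>) J) \<partial>M) =
    (\<integral>\<^sup>+\<omega>. (\<Sum>i\<in>UNIV. \<phi> (B k i, restrict (\<lambda>l. W l \<omega>) J)) / of_nat CARD('m) \<partial>M)"
proof -
  let ?P = "PiM J (\<lambda>_. borel) :: (nat \<Rightarrow> real^'m^'m) measure" and ?Y = "\<lambda>\<omega>. restrict (\<lambda>l. W l \<omega>) J"
  let ?Q = "PiM {k} (\<lambda>_. borel) :: (nat \<Rightarrow> real^'m^'m) measure" and ?X = "\<lambda>\<omega>. restrict (\<lambda>l. W l \<omega>) {k}"
  have ind: "indep_var ?Q ?X ?P ?Y"
    by (rule indep_var_restrict[OF indep_W]) (use k in auto)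
  have [measurable]: "?X \<in> measurable M ?Q" "?Y \<in> measurable M ?P"
    using indep_var_rv1[OF ind] indep_var_rv2[OF ind] by auto
  have [measurable]: "(\<lambda>g. g k) \<in> measurable ?Q borel"
    by (intro measurable_component_singleton) simp
  note [measurable] = \<phi>
  interpret D1: prob_space "distr M ?Q ?X" by (rule prob_space_distr) simp
  interpret D2: prob_space "distr M ?P ?Y" by (rule prob_space_distr) simp
  interpret D: pair_sigma_finite "distr M ?Q ?X" "distr M ?P ?Y" ..
  define \<psi> where "\<psi> p = \<phi> (fst p k, snd p)" for p
  have [measurable]: "\<psi> \<in> borel_measurable (?Q \<Otimes>\<^sub>M ?P)" unfolding \<psi>_def by measurable
  have "(\<integral>\<^sup>+\<omega>. \<phi> (W k \<omega>, ?Y \<omega>) \<partial>M) = (\<integral>\<^sup>+p. \<psi> p \<partial>distr M (?Q \<Otimes>\<^sub>M ?P) (\<lambda>\<omega>. (?X \<omega>, ?Y \<omega>)))"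
    by (subst nn_integral_distr) (auto simp: \<psi>_def)
  also have "\<dots> = (\<integral>\<^sup>+p. \<psi> p \<partial>(distr M ?Q ?X \<Otimes>\<^sub>M distr M ?P ?Y))"
    using ind by (simp add: indep_var_distribution_eq)
  also have "\<dots> = (\<integral>\<^sup>+y. \<integral>\<^sup>+g. \<psi> (g, y) \<partial>distr M ?Q ?X \<partial>distr M ?P ?Y)"
    by (intro D.nn_integral_snd[symmetric]) (simp cong: measurable_cong_sets)
  also have "\<dots> = (\<integral>\<^sup>+y. (\<Sum>i\<in>UNIV. \<phi> (B k i, y)) / of_nat CARD('m) \<partial>distr M ?P ?Y)"
  proof (rule nn_integral_cong)
    fix y assume "y \<in> space (distr M ?P ?Y)"
    then have y: "y \<in> space ?P" by simp
    then have "(\<integral>\<^sup>+g. \<psi> (g, y) \<partial>distr M ?Q ?X) = (\<integral>\<^sup>+\<omega>. \<phi> (W k \<omega>, y) \<partial>M)"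
      by (subst nn_integral_distr) (auto simp: \<psi>_def)
    also have "\<dots> = (\<Sum>i\<in>UNIV. \<phi> (B k i, y)) / of_nat CARD('m)"
      by (rule nn_integral_W) (use y in measurable)
    finally show "(\<integral>\<^sup>+g. \<psi> (g, y) \<partial>distr M ?Q ?X) = (\<Sum>i\<in>UNIV. \<phi> (B k i, y)) / of_nat CARD('m)" .
  qed
  also have "\<dots> = (\<integral>\<^sup>+\<omega>. (\<Sum>i\<in>UNIV. \<phi> (B k i, ?Y \<omega>)) / of_nat CARD('m) \<partial>M)"
    by (subst nn_integral_distr) auto
  finally show ?thesis .
qed

text \<open>This is the energy balance averaged over the waking agent, with
  \<open>1 - \<gamma>s k\<close> lowered to \<open>1 - \<gamma>\<close> so that the loss factor is
  the same at all times.\<close>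

lemma broadcast_energy_decrease:
  fixes x :: "real^'m"
  shows "(\<Sum>i\<in>UNIV. ennreal ((\<Sum>a\<in>UNIV. ((B k i *v x) $ a)\<^sup>2) + (1 - \<gamma>) * disagreement (B k i) x))
      / of_nat CARD('m) \<le> ennreal (\<Sum>a\<in>UNIV. (x $ a)\<^sup>2)"
proof -
  let ?q = "\<lambda>x :: real^'m. \<Sum>a\<in>UNIV. (x $ a)\<^sup>2"
  have dis: "0 \<le> disagreement (B k i) x" for i
    by (intro disagreement_nonneg row_stochastic_broadcast_matrix \<gamma>s_bounds)
  have nn: "0 \<le> ?q (B k i *v x) + (1 - \<gamma>) * disagreement (B k i) x" for i
    using \<gamma> dis by (intro add_nonneg_nonneg sum_nonneg mult_nonneg_nonneg) auto
  have "(\<Sum>i\<in>UNIV. ?q (B k i *v x) + (1 - \<gamma>) * disagreement (B k i) x) \<le>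
      (\<Sum>i\<in>UNIV. ?q (B k i *v x) + (1 - \<gamma>s k) * disagreement (B k i) x)"
    using \<gamma>s_le dis by (intro sum_mono add_left_mono mult_right_mono) auto
  also have "\<dots> = CARD('m) * ?q x"
    by (rule broadcast_energy_balance[OF sym_G \<gamma>s_bounds])
  finally have "(\<Sum>i\<in>UNIV. ?q (B k i *v x) + (1 - \<gamma>) * disagreement (B k i) x) / CARD('m) \<le> ?q x"
    by (simp add: field_simps)
  then have "ennreal ((\<Sum>i\<in>UNIV. ?q (B k i *v x) + (1 - \<gamma>) * disagreement (B k i) x) / CARD('m)) \<le> ennreal (?q x)"
    by (rule ennreal_leI)
  moreover have "ennreal ((\<Sum>i\<in>UNIV. ?q (B k i *v x) + (1 - \<gamma>) * disagreement (B k i) x) / CARD('m)) =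
      (\<Sum>i\<in>UNIV. ennreal (?q (B k i *v x) + (1 - \<gamma>) * disagreement (B k i) x)) / of_nat CARD('m)"
    using nn by (simp add: divide_ennreal[symmetric] sum_nonneg sum_ennreal ennreal_of_nat_eq_real_of_nat)
  ultimately show ?thesis by simp
qed

text \<open>With \<open>V\<close> the expected energy and \<open>C\<close> the expected loss,
  \<open>V (Suc n) + C n \<le> V n\<close> telescopes. A basis vector has energy 1, so the expected
  total loss is at most 1 and the loss series is finite almost surely. The positive factor
  \<open>1 - \<gamma>\<close> then drops out.\<close>

lemma AE_summable_disagreement_from:
  "AE \<omega> in M. summable (\<lambda>k. disagreement (W (t0 + k) \<omega>)
     (chain_prod (\<lambda>k. W (t0 + k) \<omega>) k *v axis l 1))"
proof -
  let ?q = "\<lambda>x :: real^'m. \<Sum>a\<in>UNIV. (x $ a)\<^sup>2"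
  define X where "X n f = chain_prod (\<lambda>k. f (t0 + k)) n *v (axis l 1 :: real^'m)"
    for n and f :: "nat \<Rightarrow> real^'m^'m"
  define x where "x n \<omega> = X n (\<lambda>k. W k \<omega>)" for n \<omega>
  have X_measurable: "(\<lambda>f. X n f $ i) \<in> borel_measurable (PiM I (\<lambda>_. borel))"
    if "{t0..<t0 + n} \<subseteq> I" for n i I
    unfolding X_def chain_prod_axis_nth by (rule chain_prod_measurable[OF that])
  have W_UNIV: "(\<lambda>\<omega> k. W k \<omega>) \<in> measurable M (PiM UNIV (\<lambda>_. borel))"
    by (rule measurable_PiM_single') auto
  have x_measurable [measurable]: "(\<lambda>\<omega>. x n \<omega> $ i) \<in> borel_measurable M" for n i
    unfolding x_def using measurable_compose[OF W_UNIV X_measurable[of n UNIV i]] by simp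
  define V where "V n = (\<integral>\<^sup>+\<omega>. ennreal (?q (x n \<omega>)) \<partial>M)" for n
  define C where "C n = (\<integral>\<^sup>+\<omega>. ennreal ((1 - \<gamma>) * disagreement (W (t0 + n) \<omega>) (x n \<omega>)) \<partial>M)" for n
  have dis_measurable [measurable]: "(\<lambda>\<omega>. disagreement (W (t0 + n) \<omega>) (x n \<omega>)) \<in> borel_measurable M" for n
    unfolding disagreement_def by measurable
  have decrease: "V (Suc n) + C n \<le> V n" for n
  proof -
    let ?J = "{t0..<t0 + n}"
    define \<phi> where "\<phi> p = ennreal (?q (fst p *v X n (snd p)) + (1 - \<gamma>) * disagreement (fst p) (X n (snd p)))" for p
    have [measurable]: "(\<lambda>p. X n (snd p) $ a) \<in> borel_measurable (borel \<Otimes>\<^sub>M PiM ?J (\<lambda>_. borel))" for a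
      by (rule measurable_compose[OF measurable_snd X_measurable]) simp
    have \<phi>: "\<phi> \<in> borel_measurable (borel \<Otimes>\<^sub>M PiM ?J (\<lambda>_. borel))"
      unfolding \<phi>_def disagreement_def matrix_vector_mult_def by simp
    \<comment> \<open>The state \<open>x n\<close> involves only the matrices with times in
      \<open>?J\<close>, so it is a function of the past that is independent of
      \<open>W (t0 + n)\<close>.\<close>
    have past: "X n (restrict (\<lambda>k. W k \<omega>) ?J) = x n \<omega>" for \<omega>
      unfolding x_def X_def by (intro arg_cong[where f = "\<lambda>A. A *v _"] chain_prod_cong) auto
    have x_Suc: "x (Suc n) \<omega> = W (t0 + n) \<omega> *v x n \<omega>" for \<omega>
      by (simp add: x_def X_def matrix_vector_mul_assoc)
    have "V (Suc n) + C n =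
        (\<integral>\<^sup>+\<omega>. ennreal (?q (x (Suc n) \<omega>)) + ennreal ((1 - \<gamma>) * disagreement (W (t0 + n) \<omega>) (x n \<omega>)) \<partial>M)"
      unfolding V_def C_def by (rule nn_integral_add[symmetric]) measurable
    also have "\<dots> = (\<integral>\<^sup>+\<omega>. \<phi> (W (t0 + n) \<omega>, restrict (\<lambda>k. W k \<omega>) ?J) \<partial>M)"
    proof (rule nn_integral_cong_AE, use AE_row_stochastic in eventually_elim)
      case (elim \<omega>)
      then have "0 \<le> (1 - \<gamma>) * disagreement (W (t0 + n) \<omega>) (x n \<omega>)"
        using \<gamma> by (intro mult_nonneg_nonneg disagreement_nonneg) auto
      then show ?case by (simp add: \<phi>_def past x_Suc ennreal_plus sum_nonneg)
    qed
    also have "\<dots> = (\<integral>\<^sup>+\<omega>. (\<Sum>i\<in>UNIV. \<phi> (B (t0 + n) i, restrict (\<lambda>k. W k \<omega>) ?J)) / of_nat CARD('m) \<partial>M)"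
      using \<phi> by (intro nn_integral_W_past) auto
    also have "\<dots> \<le> V n"
      unfolding V_def \<phi>_def fst_conv snd_conv past by (intro nn_integral_mono broadcast_energy_decrease)
    finally show ?thesis .
  qed
  have "x 0 \<omega> = axis l 1" for \<omega> by (simp add: x_def X_def)
  then have "V 0 = 1"
    by (simp add: V_def axis_def if_distrib[of "\<lambda>x. x\<^sup>2"] emeasure_space_1 cong: if_cong)
  moreover have "V n + (\<Sum>k<n. C k) \<le> V 0" for n
  proof (induction n)
    case (Suc n)
    have "V (Suc n) + (\<Sum>k<Suc n. C k) = (V (Suc n) + C n) + (\<Sum>k<n. C k)"
      by (simp add: algebra_simps)
    also have "\<dots> \<le> V n + (\<Sum>k<n. C k)" by (intro add_right_mono decrease)
    finally show ?case using Suc by (rule order_trans)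
  qed simp
  ultimately have "(\<Sum>k<n. C k) \<le> 1" for n
    by (metis add.commute add_increasing2 order_refl order_trans zero_le)
  then have "(\<Sum>k. C k) \<le> 1" by (intro suminf_le_const) auto
  moreover have "(\<integral>\<^sup>+\<omega>. (\<Sum>k. ennreal ((1 - \<gamma>) * disagreement (W (t0 + k) \<omega>) (x k \<omega>))) \<partial>M) = (\<Sum>k. C k)"
    unfolding C_def by (rule nn_integral_suminf) measurable
  ultimately have "(\<integral>\<^sup>+\<omega>. (\<Sum>k. ennreal ((1 - \<gamma>) * disagreement (W (t0 + k) \<omega>) (x k \<omega>))) \<partial>M) \<noteq> \<infinity>"
    by (auto simp: top_unique)
  then have "AE \<omega> in M. (\<Sum>k. ennreal ((1 - \<gamma>) * disagreement (W (t0 + k) \<omega>) (x k \<omega>))) \<noteq> \<infinity>"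
    by (intro nn_integral_PInf_AE) measurable
  then show ?thesis
    using AE_row_stochastic
  proof eventually_elim
    case (elim \<omega>)
    have "summable (\<lambda>k. (1 - \<gamma>) * disagreement (W (t0 + k) \<omega>) (x k \<omega>))"
      using elim \<gamma> by (intro summable_suminf_not_top mult_nonneg_nonneg disagreement_nonneg) auto
    then show ?case using \<gamma> by (simp add: summable_cmult_iff x_def X_def)
  qed
qed

lemma AE_summable_disagreement: "AE \<omega> in M. summable_disagreement (\<lambda>k. W k \<omega>)"
  unfolding summable_disagreement_def AE_all_countable
  using AE_summable_disagreement_from by blast

section \<open>Infinite flow and separation across cuts\<close>

text \<open>By independence, the mean of exp(-\<open>S n\<close>) factorizes and is at most
  exp(-s/(2m)), where s is the partial sum of the edge weights and m the number of agents. As s is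
  unbounded, these means tend to 0, which forces the accumulated flow to be unbounded almost
  surely.\<close>

lemma AE_infinite_flow:
  assumes uv: "u \<noteq> v" and ns: "\<not> summable (\<lambda>k. edge_weight (G k) (\<gamma>s k) u v)"
  shows "AE \<omega> in M. filterlim (\<lambda>n. \<Sum>k<n. W k \<omega> $ u $ v + W k \<omega> $ v $ u) at_top sequentially"
proof -
  let ?w = "\<lambda>k. edge_weight (G k) (\<gamma>s k) u v" and ?C = "real CARD('m)"
  define S where "S n \<omega> = (\<Sum>k<n. W k \<omega> $ u $ v + W k \<omega> $ v $ u)" for n \<omega>
  have w: "0 \<le> ?w k" "?w k \<le> 1" for k
    using \<gamma>s_bounds[of k] by (auto simp: edge_weight_def)
  define f :: "real^'m^'m \<Rightarrow> real" where "f A = exp (- (A $ u $ v + A $ v $ u))" for A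
  have f_measurable [measurable]: "f \<in> borel_measurable borel" unfolding f_def by measurable
  have f_mean: "(\<integral>\<^sup>+\<omega>. ennreal (f (W k \<omega>)) \<partial>M) \<le> ennreal (exp (- (?w k / (2 * ?C))))" for k
  proof -
    \<comment> \<open>Only the waking of \<open>u\<close> is exploited; for every other agent the
      trivial bound 1 suffices.\<close>
    have "(\<Sum>i\<in>UNIV. f (B k i)) \<le> (\<Sum>i\<in>UNIV. 1 - (if i = u then ?w k / 2 else 0))"
      by (intro sum_mono)
         (use w[of k] exp_minus_le_half[OF w] in \<open>auto simp: f_def broadcast_matrix_flow[OF sym_G uv]\<close>)
    also have "\<dots> = ?C - ?w k / 2" by (simp add: sum_subtractf)
    finally have "(\<Sum>i\<in>UNIV. f (B k i)) / ?C \<le> (?C - ?w k / 2) / ?C"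
      by (intro divide_right_mono) auto
    also have "\<dots> = 1 + - (?w k / (2 * ?C))" by (simp add: field_simps)
    also have "\<dots> \<le> exp (- (?w k / (2 * ?C)))" by (rule exp_ge_add_one_self)
    finally have "ennreal ((\<Sum>i\<in>UNIV. f (B k i)) / ?C) \<le> ennreal (exp (- (?w k / (2 * ?C))))"
      by (rule ennreal_leI)
    moreover have "(\<integral>\<^sup>+\<omega>. ennreal (f (W k \<omega>)) \<partial>M) = ennreal ((\<Sum>i\<in>UNIV. f (B k i)) / ?C)"
      by (subst nn_integral_W)
         (auto simp: divide_ennreal[symmetric] sum_nonneg sum_ennreal ennreal_of_nat_eq_real_of_nat f_def)
    ultimately show ?thesis by simp
  qed
  have S_mean: "(\<integral>\<^sup>+\<omega>. ennreal (exp (- S n \<omega>)) \<partial>M) \<le> ennreal (exp (- ((\<Sum>k<n. ?w k) / (2 * ?C))))" for n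
  proof -
    have "indep_vars (\<lambda>_. borel) (\<lambda>k \<omega>. ennreal (f (W k \<omega>))) {..<n}"
      by (rule indep_vars_compose2[OF indep_vars_subset[OF indep_W]]) auto
    then have "(\<integral>\<^sup>+\<omega>. (\<Prod>k<n. ennreal (f (W k \<omega>))) \<partial>M) = (\<Prod>k<n. \<integral>\<^sup>+\<omega>. ennreal (f (W k \<omega>)) \<partial>M)"
      by (intro indep_vars_nn_integral) auto
    also have "\<dots> \<le> (\<Prod>k<n. ennreal (exp (- (?w k / (2 * ?C)))))"
      by (intro prod_mono_ennreal) (use f_mean in auto)
    also have "\<dots> = ennreal (exp (- ((\<Sum>k<n. ?w k) / (2 * ?C))))"
      by (simp add: prod_ennreal exp_sum[symmetric] sum_negf sum_divide_distrib)
    finally show ?thesis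
      by (simp add: prod_ennreal f_def exp_sum[symmetric] S_def sum_negf[symmetric])
  qed
  have S_measurable [measurable]: "S n \<in> borel_measurable M" for n unfolding S_def by measurable
  \<comment> \<open>\<open>Z\<close> vanishes exactly where the partial flows \<open>S n\<close> are
    unbounded above. Its mean lies below every \<open>exp (- b)\<close>, hence is 0.\<close>
  define Z where "Z \<omega> = (INF n. ennreal (exp (- S n \<omega>)))" for \<omega>
  have Z_measurable [measurable]: "Z \<in> borel_measurable M" unfolding Z_def by measurable
  have Z_mean: "(\<integral>\<^sup>+\<omega>. Z \<omega> \<partial>M) \<le> ennreal (exp (- b))" for b
  proof -
    obtain n where n: "b * (2 * ?C) < (\<Sum>k<n. ?w k)"
      using ns summableI_nonneg_bounded[of ?w "b * (2 * ?C)", OF w(1)] by (meson not_le)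
    have "(\<integral>\<^sup>+\<omega>. Z \<omega> \<partial>M) \<le> (\<integral>\<^sup>+\<omega>. ennreal (exp (- S n \<omega>)) \<partial>M)"
      unfolding Z_def by (intro nn_integral_mono INF_lower) simp
    also have "\<dots> \<le> ennreal (exp (- ((\<Sum>k<n. ?w k) / (2 * ?C))))" by (rule S_mean)
    also have "\<dots> \<le> ennreal (exp (- b))"
      using n by (intro ennreal_leI) (simp add: field_simps)
    finally show ?thesis .
  qed
  have "(\<integral>\<^sup>+\<omega>. Z \<omega> \<partial>M) \<le> 0"
  proof (rule ennreal_le_epsilon)
    fix e :: real assume "0 < e"
    then show "(\<integral>\<^sup>+\<omega>. Z \<omega> \<partial>M) \<le> 0 + ennreal e" using Z_mean[of "- ln e"] by simp
  qed
  then have "AE \<omega> in M. Z \<omega> = 0"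
    by (simp add: nn_integral_0_iff_AE)
  then show ?thesis
    using AE_row_stochastic
  proof eventually_elim
    case (elim \<omega>)
    have mono: "S m \<omega> \<le> S n \<omega>" if "m \<le> n" for m n
      unfolding S_def using that elim
      by (intro sum_mono2) (auto intro!: add_nonneg_nonneg row_stochastic_nonneg)
    have "filterlim (\<lambda>n. S n \<omega>) at_top sequentially"
      unfolding filterlim_at_top_dense
    proof
      fix b
      have "Z \<omega> < ennreal (exp (- b))" using elim by simp
      then obtain m where "ennreal (exp (- S m \<omega>)) < ennreal (exp (- b))"
        unfolding Z_def INF_less_iff by auto
      then have "b < S m \<omega>" by (simp add: ennreal_less_iff)
      then have "\<forall>n\<ge>m. b < S n \<omega>" using mono by (blast intro: less_le_trans)
      then show "\<forall>\<^sub>F n in sequentially. b < S n \<omega>" by (auto simp: eventually_sequentially)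
    qed
    then show ?case by (simp add: S_def)
  qed
qed

text \<open>Finitely many pairs cross the cut, so their total weight \<open>q\<close> is summable
  and has tail at most 1/4 from some \<open>t0\<close> on. This \<open>t0\<close> is the same for
  all realizations, and \<open>cut_flow_of_weakly_ergodic\<close> would require more flow than
  that.\<close>

lemma AE_not_weakly_ergodic_across_cut:
  assumes cut: "\<And>u v. u \<in> S \<Longrightarrow> v \<notin> S \<Longrightarrow> summable (\<lambda>k. edge_weight (G k) (\<gamma>s k) u v)"
    and ij: "i \<in> S" "j \<notin> S"
  shows "AE \<omega> in M. \<not> mutually_weakly_ergodic (\<lambda>k. W k \<omega>) i j"
proof -
  define q where "q k = (\<Sum>u\<in>S. \<Sum>v\<in>-S. edge_weight (G k) (\<gamma>s k) u v)" for k
  have w: "0 \<le> edge_weight (G k) (\<gamma>s k) u v" for k u v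
    using \<gamma>s_bounds[of k] by (auto simp: edge_weight_def)
  have q: "summable q" unfolding q_def using cut by (intro summable_sum) auto
  obtain t0 where t0: "\<And>n. n \<ge> t0 \<Longrightarrow> norm (\<Sum>k. q (k + n)) < 1 / 4"
    using suminf_exist_split[OF _ q, of "1 / 4"] by auto
  have tail: "(\<Sum>k<n. q (t0 + k)) \<le> 1 / 4" for n
  proof -
    have "(\<Sum>k<n. q (k + t0)) \<le> (\<Sum>k. q (k + t0))"
      by (intro sum_le_suminf summable_ignore_initial_segment[OF q]) (auto simp: q_def intro!: sum_nonneg w)
    also have "\<dots> \<le> 1 / 4" using t0[of t0] by simp
    finally show ?thesis by (simp add: add.commute)
  qed
  \<comment> \<open>Whichever agent wakes, the flow between \<open>u\<close> and \<open>v\<close> is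
    either 0 or the edge weight, so the random flow has a deterministic bound.\<close>
  have flow: "cut_flow (B k l) S \<le> q k" for k l
    unfolding cut_flow_def q_def
  proof (intro sum_mono)
    fix u v assume "u \<in> S" "v \<in> - S"
    then have "u \<noteq> v" by auto
    then show "B k l $ u $ v + B k l $ v $ u \<le> edge_weight (G k) (\<gamma>s k) u v"
      using w[of k u v] by (simp add: broadcast_matrix_flow[OF sym_G])
  qed
  show ?thesis
    using AE_W_range AE_row_stochastic
  proof eventually_elim
    case (elim \<omega>)
    have "cut_flow (W k \<omega>) S \<le> q k" for k using elim flow by metis
    then have "(\<Sum>k<n. cut_flow (W (t0 + k) \<omega>) S) \<le> 1 / 4" for n
      by (intro order_trans[OF sum_mono tail]) auto
    then show ?case
      using cut_flow_of_weakly_ergodic[of "\<lambda>k. W k \<omega>" i j S t0] elim ij by (auto simp: not_less[symmetric])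
  qed
qed

end

subsection \<open>Components of the infinite flow graph\<close>

text \<open>In the graph library, \<open>connected\<close> means strong connectivity of the
  symmetrized digraph, which for a symmetric digraph is its own strong connectivity. Reachability
  also demands membership in the vertex set; as that set is \<open>UNIV\<close>, it becomes the
  plain closure of the arcs.\<close>

lemma (in pair_sym_digraph) connected_iff_rtrancl:
  assumes "pverts G = UNIV"
  shows "Digraph_Component.connected (with_proj G) \<longleftrightarrow> (\<forall>i j. (i, j) \<in> (parcs G)\<^sup>*)"
proof -
  have reach: "i \<rightarrow>\<^sup>*\<^bsub>with_proj G\<^esub> j \<longleftrightarrow> (i, j) \<in> (parcs G)\<^sup>*" for i j
    using reachable_conv'[of i j] assms by simp
  have "Digraph_Component.connected (with_proj G) \<longleftrightarrow> strongly_connected (with_proj G)"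
    using symmetric_connected_imp_strongly_connected[OF pair_sym_arcs]
    by (auto simp: connected_def strongly_connected_def intro: reachable_mk_symmetricI)
  then show ?thesis by (simp add: strongly_connected_def reach assms)
qed

lemma (in pair_sym_digraph) same_component_iff_rtrancl:
  assumes V: "pverts G = UNIV"
  shows "(\<exists>H\<in>connected_components G. i \<in> verts H \<and> j \<in> verts H) \<longleftrightarrow> (i, j) \<in> (parcs G)\<^sup>*"
proof -
  have reach: "u \<rightarrow>\<^sup>*\<^bsub>with_proj G\<^esub> v \<longleftrightarrow> (u, v) \<in> (parcs G)\<^sup>*" for u v
    using reachable_conv'[of u v] V by simp
  have sub: "u \<rightarrow>\<^sup>*\<^bsub>with_proj G\<^esub> v"
    if "subgraph H (with_proj G)" "Digraph_Component.connected H" "u \<in> verts H" "v \<in> verts H" for H u v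
  proof -
    have "u \<rightarrow>\<^sup>*\<^bsub>with_proj (mk_symmetric H)\<^esub> v"
      using that by (auto simp: connected_def strongly_connected_def)
    then have "u \<rightarrow>\<^sup>*\<^bsub>with_proj (mk_symmetric (with_proj G))\<^esub> v"
      by (rule pre_digraph.reachable_mono[OF _ subgraph_mk_symmetric[OF that(1)]])
    then show ?thesis
      by (simp add: reachable_mk_symmetric_eq[OF pair_sym_arcs])
  qed
  show ?thesis
  proof
    assume "\<exists>H\<in>connected_components G. i \<in> verts H \<and> j \<in> verts H"
    then show "(i, j) \<in> (parcs G)\<^sup>*"
      using sub by (auto simp: connected_components_def max_subgraph_def reach)
  next
    assume ij: "(i, j) \<in> (parcs G)\<^sup>*"
    \<comment> \<open>The component is the subgraph induced by everything reachable from
      \<open>i\<close>, already known to be a strongly connected component.\<close>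
    let ?C = "with_proj G \<restriction> {v. i \<rightarrow>\<^sup>*\<^bsub>with_proj G\<^esub> v}"
    have C: "?C \<in> sccs" by (rule induce_reachable_is_in_sccs) (simp add: V)
    then have subC: "subgraph ?C (with_proj G)" and sc: "strongly_connected ?C"
      by (auto simp: sccs_def)
    interpret C: wf_digraph ?C using subC by (rule subgraphE)
    have "Digraph_Component.connected ?C"
      using sc by (auto simp: connected_def strongly_connected_def intro: C.reachable_mk_symmetricI)
    \<comment> \<open>Maximality: a connected \<open>H\<close> above \<open>?C\<close> contains
      \<open>i\<close>, so its vertices are reachable from \<open>i\<close>; since \<open>?C\<close>
      is induced, \<open>H\<close> has no further arcs either.\<close>
    moreover have "H = ?C"
      if H: "subgraph ?C H" "subgraph H (with_proj G)" "Digraph_Component.connected H" for H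
    proof -
      have "i \<in> verts H" using H(1) by (auto simp: subgraph_def reach)
      then have "verts H \<subseteq> verts ?C" using sub H by auto
      then have verts: "verts H = verts ?C" using H(1) by (auto simp: subgraph_def)
      have ends: "tail H = tail ?C" "head H = head ?C"
        using H(1) by (auto simp: subgraph_def compatible_def)
      interpret H: wf_digraph H using H(2) by (rule subgraphE)
      have "arcs H \<subseteq> arcs ?C"
      proof
        fix e assume "e \<in> arcs H"
        then show "e \<in> arcs ?C"
          using H.wellformed[of e] H(2) ends verts by (auto simp: subgraph_def)
      qed
      then have "arcs H = arcs ?C" using H(1) by (auto simp: subgraph_def)
      with verts ends show ?thesis by (intro pre_digraph.equality) auto
    qed
    ultimately have "?C \<in> connected_components G"
      using subC by (auto simp: connected_components_def max_subgraph_def)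
    then show "\<exists>H\<in>connected_components G. i \<in> verts H \<and> j \<in> verts H"
      using ij by (intro bexI[of _ ?C]) (auto simp: reach)
  qed
qed

lemma pair_sym_digraph_infinite_flow_graph: "pair_sym_digraph (infinite_flow_graph M W)"
  by unfold_locales (auto simp: infinite_flow_graph_def symmetric_def sym_def add.commute)

lemma pverts_infinite_flow_graph [simp]: "pverts (infinite_flow_graph M W) = UNIV"
  by (simp add: infinite_flow_graph_def)

text \<open>Finitely many almost sure events occur together, so the almost sure relation inherits
  reflexivity, symmetry and transitivity from single chains. Sharing a class of an equivalence is
  the same as being related.\<close>

lemma same_ergodicity_class_iff:
  "(\<exists>C\<in>ergodicity_classes M W. i \<in> C \<and> j \<in> C) \<longleftrightarrow>
    (AE \<omega> in M. mutually_weakly_ergodic (\<lambda>k. W k \<omega>) i j)"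
proof -
  let ?R = "{(i, j). AE \<omega> in M. mutually_weakly_ergodic (\<lambda>k. W k \<omega>) i j}"
  have "trans ?R"
    by (auto intro!: transI elim!: AE_mp intro: mutually_weakly_ergodic_trans)
  then have R: "equiv UNIV ?R"
    by (auto intro!: equivI refl_onI symI elim!: AE_mp simp: mutually_weakly_ergodic_refl mutually_weakly_ergodic_sym)
  have "(\<exists>C\<in>UNIV // ?R. i \<in> C \<and> j \<in> C) \<longleftrightarrow> (i, j) \<in> ?R"
  proof
    assume "\<exists>C\<in>UNIV // ?R. i \<in> C \<and> j \<in> C"
    then show "(i, j) \<in> ?R" using in_quotient_imp_in_rel[OF R] by blast
  next
    assume "(i, j) \<in> ?R"
    then have "i \<in> ?R `` {i}" "j \<in> ?R `` {i}"
      using equiv_class_self[OF R, of i] by blast+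
    then show "\<exists>C\<in>UNIV // ?R. i \<in> C \<and> j \<in> C"
      by (intro bexI[of _ "?R `` {i}"] quotientI) auto
  qed
  then show ?thesis by (simp add: ergodicity_classes_def)
qed

lemma (in broadcast_gossip) AE_weakly_ergodic_iff_rtrancl:
  "(AE \<omega> in M. mutually_weakly_ergodic (\<lambda>k. W k \<omega>) i j) \<longleftrightarrow>
    (i, j) \<in> (parcs (infinite_flow_graph M W))\<^sup>*"
proof
  assume "(i, j) \<in> (parcs (infinite_flow_graph M W))\<^sup>*"
  then show "AE \<omega> in M. mutually_weakly_ergodic (\<lambda>k. W k \<omega>) i j"
  proof (induction rule: rtrancl_induct)
    case base
    show ?case by (simp add: mutually_weakly_ergodic_refl)
  next
    case (step u v)
    from step.hyps(2) have "AE \<omega> in M.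
        filterlim (\<lambda>n. \<Sum>k<n. W k \<omega> $ u $ v + W k \<omega> $ v $ u) at_top sequentially"
      by (simp add: infinite_flow_graph_def)
    with step.IH AE_row_stochastic AE_summable_disagreement show ?case
      by eventually_elim (blast intro: mutually_weakly_ergodic_trans weakly_ergodic_of_infinite_flow)
  qed
next
  assume erg: "AE \<omega> in M. mutually_weakly_ergodic (\<lambda>k. W k \<omega>) i j"
  let ?F = "parcs (infinite_flow_graph M W)"
  show "(i, j) \<in> ?F\<^sup>*"
  proof (rule ccontr)
    assume ij: "(i, j) \<notin> ?F\<^sup>*"
    \<comment> \<open>\<open>S\<close> is the vertex set of the component of \<open>i\<close>. A
      pair leaving \<open>S\<close> with nonsummable weights would be an edge by
      \<open>AE_infinite_flow\<close> and would extend \<open>S\<close>, so \<open>S\<close> is a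
      cut with summable weights.\<close>
    define S where "S = {v. (i, v) \<in> ?F\<^sup>*}"
    have "summable (\<lambda>k. edge_weight (G k) (\<gamma>s k) u v)" if "u \<in> S" "v \<notin> S" for u v
    proof (rule ccontr)
      assume "\<not> ?thesis"
      moreover have "u \<noteq> v" using that by auto
      ultimately have "(u, v) \<in> ?F" using AE_infinite_flow by (simp add: infinite_flow_graph_def)
      then show False using that by (auto simp: S_def intro: rtrancl_into_rtrancl)
    qed
    then have "AE \<omega> in M. \<not> mutually_weakly_ergodic (\<lambda>k. W k \<omega>) i j"
      using ij by (intro AE_not_weakly_ergodic_across_cut[of S]) (auto simp: S_def)
    with erg have "AE \<omega> in M. False" by eventually_elim simp
    then show False by simp
  qed
qed

theorem lemma5:
  fixes M :: "'w measure"
    and G :: "nat \<Rightarrow> 'm::finite pair_pre_digraph"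
    and \<gamma> :: real and \<gamma>s :: "nat \<Rightarrow> real"
    and W :: "nat \<Rightarrow> 'w \<Rightarrow> real^'m^'m"
  assumes "\<And>k. pair_graph (G k)" and "\<And>k. pverts (G k) = UNIV"
    and "0 < \<gamma>" and "\<gamma> < 1"
    and "\<And>k. 0 < \<gamma>s k" and "\<And>k. \<gamma>s k \<le> \<gamma>"
    and "broadcast_gossip_model M G \<gamma>s W"
  shows "(AE \<omega> in M. stable_chain (\<lambda>k. W k \<omega>)) \<and>
    (\<forall>i j. (\<exists>C \<in> ergodicity_classes M W. i \<in> C \<and> j \<in> C) \<longleftrightarrow>
           (\<exists>H \<in> connected_components (infinite_flow_graph M W). i \<in> verts H \<and> j \<in> verts H)) \<and>
    ((AE \<omega> in M. ergodic_chain (\<lambda>k. W k \<omega>)) \<longleftrightarrow>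
      Digraph_Component.connected (with_proj (infinite_flow_graph M W)))"
proof -
  interpret broadcast_gossip M G \<gamma> \<gamma>s W
    by (intro broadcast_gossip.intro assms)
  interpret F: pair_sym_digraph "infinite_flow_graph M W" by (rule pair_sym_digraph_infinite_flow_graph)
  have "AE \<omega> in M. stable_chain (\<lambda>k. W k \<omega>)"
    using AE_row_stochastic AE_summable_disagreement
    by eventually_elim (blast intro: stable_of_summable_disagreement)
  moreover have "(AE \<omega> in M. ergodic_chain (\<lambda>k. W k \<omega>)) \<longleftrightarrow>
      (\<forall>i j. AE \<omega> in M. mutually_weakly_ergodic (\<lambda>k. W k \<omega>) i j)"
    by (simp add: ergodic_chain_def AE_all_countable)
  ultimately show ?thesis
    by (simp add: same_ergodicity_class_iff AE_weakly_ergodic_iff_rtrancl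
        F.same_component_iff_rtrancl F.connected_iff_rtrancl)
qed

end
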